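(* Let $F=\{f_i\}_{i=1}^N$ be a Parseval $K$-frame for $\mathcal{H}_n$ with $N>n$, where $K$ is a positive semi-definite operator on $\mathcal{H}_n$. Let $M:=\max\{\|(K^\dagger)^{1/2}f_i\|^2:1\le i\le N\}$, $J_1:=\{i:\|(K^\dagger)^{1/2}f_i\|^2=M\}$, $J_2:=\{1,\dots,N\}\setminus J_1$, and $W_j:=\operatorname{span}\{f_i:i\in J_j\}$ for $j=1,2$. If $W_1\cap W_2=\{0\}$ and $\{f_i\}_{i\in J_1}$ is linearly independent, then the canonical $K$-dual $\{K^\dagger f_i\}_{i=1}^N$ is a $1$-erasure spectrally optimal $K$-dual of $F$. Moreover, the set of $1$-erasure spectrally optimal $K$-duals of $F$ is uncountable.
   Context: $\mathcal{H}_n$ is an $n$-dimensional Hilbert space (over $\mathbb{R}$ or $\mathbb{C}$), $n\ge1$. For a bounded operator $K$ on $\mathcal{H}_n$, a sequence $F=\{f_i\}_{i=1}^N\subset\mathcal{H}_n$ is a Parseval $K$-frame if $\sum_{i=1}^N|\langle f,f_i\rangle|^2=\|K^*f\|^2$ for all $f$. A sequence $G=\{g_i\}_{i=1}^N\subset\mathcal{H}_n$ is a $K$-dual of $F$ if $Kf=\sum_{i=1}^N\langle f,g_i\rangle f_i$ for all $f\in\mathcal{H}_n$. $K^\dagger$ is the Moore–Penrose pseudoinverse of $K$; for a Parseval $K$-frame $F$, $\{K^\dagger f_i\}_{i=1}^N$ is a $K$-dual, called the canonical $K$-dual. For a $K$-dual $G$ of $F$, $r_1(F,G):=\max_{1\le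 i\le N}|\langle f_i,g_i\rangle|$ (the maximum spectral radius of the error operators $f\mapsto\langle f,f_i\rangle g_i$). Set $\tilde r_1(F):=\inf\{r_1(F,G):G\text{ is a }K\text{-dual of }F\}$; a $K$-dual $\tilde G$ of $F$ is $1$-erasure spectrally optimal if $r_1(F,\tilde G)=\tilde r_1(F)$. *)

theory Defs
  imports Complex_Main "HOL-Library.Countable_Set" "HOL-Library.Cardinality"
begin

section \<open>Scalars\<close>

text \<open>
  A scalar field that is \<open>\<real>\<close> or \<open>\<complex>\<close>: a real normed field with an isometric embedding of real
  algebras into the complex numbers whose range is one of these two. (The embedding maps
  1 to 1 and is injective, by multiplicativity and preservation of the norm.)
\<close>

class real_or_complex = real_normed_field +
  fixes to_complex :: "'a \<Rightarrow> complex"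
  assumes to_complex_add: "to_complex (x + y) = to_complex x + to_complex y"
    and to_complex_mult: "to_complex (x * y) = to_complex x * to_complex y"
    and to_complex_scaleR: "to_complex (r *\<^sub>R x) = r *\<^sub>R to_complex x"
    and norm_to_complex: "norm (to_complex x) = norm x"
    and range_to_complex: "range to_complex = \<real> \<or> range to_complex = UNIV"

instantiation real :: real_or_complex
begin

definition to_complex_real :: "real \<Rightarrow> complex" where
  "to_complex_real = complex_of_real"

instance
  by standard (simp_all add: to_complex_real_def Reals_def scaleR_conv_of_real)

end

instantiation complex :: real_or_complex
begin

definition to_complex_complex :: "complex \<Rightarrow> complex" where
  "to_complex_complex = (\<lambda>z. z)"

instance
  by standard (simp_all add: to_complex_complex_def)

end

definition scalar_conj :: "'k::real_or_complex \<Rightarrow> 'k" where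
  "scalar_conj a = (THE b. to_complex b = cnj (to_complex a))"

section \<open>Finite-dimensional Hilbert spaces and their operators\<close>

text \<open>The inner product is linear in the first argument. Completeness is automatic in finite
  dimension, and so is boundedness of linear operators.\<close>

locale finite_dim_hilbert = vector_space scale
  for scale :: "'k::real_or_complex \<Rightarrow> 'h::ab_group_add \<Rightarrow> 'h" +
  fixes ip :: "'h \<Rightarrow> 'h \<Rightarrow> 'k"
  assumes ip_add: "ip (x + y) z = ip x z + ip y z"
    and ip_scale: "ip (scale a x) y = a * ip x y"
    and ip_conj: "ip y x = scalar_conj (ip x y)"
    and ip_nonneg: "0 \<le> Re (to_complex (ip x x))"
    and ip_eq_0: "ip x x = 0 \<longleftrightarrow> x = 0"
    and finite_dim: "\<exists>B. finite B \<and> span B = UNIV"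

definition hnorm :: "('h \<Rightarrow> 'h \<Rightarrow> 'k::real_or_complex) \<Rightarrow> 'h \<Rightarrow> real" where
  "hnorm ip x = sqrt (Re (to_complex (ip x x)))"

definition hadjoint :: "('h \<Rightarrow> 'h \<Rightarrow> 'k::real_or_complex) \<Rightarrow> ('h \<Rightarrow> 'h) \<Rightarrow> 'h \<Rightarrow> 'h" where
  "hadjoint ip A = (THE B. \<forall>x y. ip (A x) y = ip x (B y))"

text \<open>Self-adjointness is part of the definition; over \<open>\<complex>\<close> it would follow from nonnegativity
  of the quadratic form, over \<open>\<real>\<close> it would not.\<close>

definition positive_semidef ::
  "('k::real_or_complex \<Rightarrow> 'h::ab_group_add \<Rightarrow> 'h) \<Rightarrow> ('h \<Rightarrow> 'h \<Rightarrow> 'k) \<Rightarrow> ('h \<Rightarrow> 'h) \<Rightarrow> bool" where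
  "positive_semidef scale ip A \<longleftrightarrow>
     Vector_Spaces.linear scale scale A \<and> hadjoint ip A = A \<and>
     (\<forall>x. 0 \<le> Re (to_complex (ip (A x) x)))"

text \<open>The positive semi-definite square root.\<close>

definition op_sqrt ::
  "('k::real_or_complex \<Rightarrow> 'h::ab_group_add \<Rightarrow> 'h) \<Rightarrow> ('h \<Rightarrow> 'h \<Rightarrow> 'k) \<Rightarrow> ('h \<Rightarrow> 'h) \<Rightarrow> 'h \<Rightarrow> 'h" where
  "op_sqrt scale ip A = (THE S. positive_semidef scale ip S \<and> S \<circ> S = A)"

text \<open>The Moore--Penrose pseudoinverse, as the unique solution of the four Penrose equations.\<close>

definition mp_inverse ::
  "('k::real_or_complex \<Rightarrow> 'h::ab_group_add \<Rightarrow> 'h) \<Rightarrow> ('h \<Rightarrow> 'h \<Rightarrow> 'k) \<Rightarrow> ('h \<Rightarrow> 'h) \<Rightarrow> 'h \<Rightarrow> 'h" where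
  "mp_inverse scale ip A = (THE X. Vector_Spaces.linear scale scale X \<and>
     A \<circ> X \<circ> A = A \<and> X \<circ> A \<circ> X = X \<and>
     hadjoint ip (A \<circ> X) = A \<circ> X \<and> hadjoint ip (X \<circ> A) = X \<circ> A)"

section \<open>Frames, duals and optimality\<close>

text \<open>A sequence of length \<open>N\<close> is a function on a finite index type of cardinality \<open>N\<close>.\<close>

definition parseval_K_frame ::
  "('h \<Rightarrow> 'h \<Rightarrow> 'k::real_or_complex) \<Rightarrow> ('h \<Rightarrow> 'h) \<Rightarrow> ('i::finite \<Rightarrow> 'h) \<Rightarrow> bool" where
  "parseval_K_frame ip K f \<longleftrightarrow>
     (\<forall>x. (\<Sum>i\<in>UNIV. (norm (ip x (f i)))\<^sup>2) = (hnorm ip (hadjoint ip K x))\<^sup>2)"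

definition K_dual ::
  "('k::real_or_complex \<Rightarrow> 'h::ab_group_add \<Rightarrow> 'h) \<Rightarrow> ('h \<Rightarrow> 'h \<Rightarrow> 'k) \<Rightarrow> ('h \<Rightarrow> 'h)
     \<Rightarrow> ('i::finite \<Rightarrow> 'h) \<Rightarrow> ('i \<Rightarrow> 'h) \<Rightarrow> bool" where
  "K_dual scale ip K f g \<longleftrightarrow> (\<forall>x. K x = (\<Sum>i\<in>UNIV. scale (ip x (g i)) (f i)))"

definition canonical_K_dual ::
  "('k::real_or_complex \<Rightarrow> 'h::ab_group_add \<Rightarrow> 'h) \<Rightarrow> ('h \<Rightarrow> 'h \<Rightarrow> 'k) \<Rightarrow> ('h \<Rightarrow> 'h)
     \<Rightarrow> ('i::finite \<Rightarrow> 'h) \<Rightarrow> 'i \<Rightarrow> 'h" where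
  "canonical_K_dual scale ip K f = (\<lambda>i. mp_inverse scale ip K (f i))"

definition r1 ::
  "('h \<Rightarrow> 'h \<Rightarrow> 'k::real_or_complex) \<Rightarrow> ('i::finite \<Rightarrow> 'h) \<Rightarrow> ('i \<Rightarrow> 'h) \<Rightarrow> real" where
  "r1 ip f g = (MAX i. norm (ip (f i) (g i)))"

definition r1_opt ::
  "('k::real_or_complex \<Rightarrow> 'h::ab_group_add \<Rightarrow> 'h) \<Rightarrow> ('h \<Rightarrow> 'h \<Rightarrow> 'k) \<Rightarrow> ('h \<Rightarrow> 'h)
     \<Rightarrow> ('i::finite \<Rightarrow> 'h) \<Rightarrow> real" where
  "r1_opt scale ip K f = Inf {r1 ip f g | g. K_dual scale ip K f g}"

definition spectrally_optimal_K_dual ::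
  "('k::real_or_complex \<Rightarrow> 'h::ab_group_add \<Rightarrow> 'h) \<Rightarrow> ('h \<Rightarrow> 'h \<Rightarrow> 'k) \<Rightarrow> ('h \<Rightarrow> 'h)
     \<Rightarrow> ('i::finite \<Rightarrow> 'h) \<Rightarrow> ('i \<Rightarrow> 'h) \<Rightarrow> bool" where
  "spectrally_optimal_K_dual scale ip K f g \<longleftrightarrow>
     K_dual scale ip K f g \<and> r1 ip f g = r1_opt scale ip K f"

end

theory Submission
  imports Defs
    "HOL-Computational_Algebra.Fundamental_Theorem_Algebra"
    "HOL-Analysis.Continuum_Not_Denumerable"
begin

text \<open>
  Write \<open>g\<^sub>0 = (K\<^sup>\<dagger> f\<^sub>i)\<close> for the canonical dual. The difference of two \<open>K\<close>-duals gives, after pairing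
  with any \<open>x\<close>, a linear relation among the \<open>f\<^sub>i\<close>. Since \<open>W\<^sub>1\<close> and \<open>W\<^sub>2\<close> meet only in \<open>0\<close> and the
  \<open>f\<^sub>i\<close> with index in \<open>J\<^sub>1\<close> are independent, such a relation has zero coefficients on \<open>J\<^sub>1\<close>
  (\<open>relation_vanishes_on_independent_part\<close>). So all duals agree with \<open>g\<^sub>0\<close> on \<open>J\<^sub>1\<close>, where
  \<open>\<langle>f\<^sub>i, K\<^sup>\<dagger> f\<^sub>i\<rangle> = \<parallel>(K\<^sup>\<dagger>)\<^sup>1\<^sup>/\<^sup>2 f\<^sub>i\<parallel>\<^sup>2 = M\<close>. Hence no dual does better than \<open>M\<close>, and \<open>g\<^sub>0\<close> attains it
  because \<open>M\<close> is the maximum of these numbers.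

  For the second claim, \<open>N > n\<close> yields a nontrivial relation \<open>\<Sum> c\<^sub>i f\<^sub>i = 0\<close>, supported on \<open>J\<^sub>2\<close> by the
  same argument. Adding \<open>t\<close> times the conjugate of \<open>c\<^sub>i\<close> times a fixed \<open>v \<noteq> 0\<close> to the \<open>i\<close>-th vector of
  \<open>g\<^sub>0\<close> gives a dual again, and on \<open>J\<^sub>2\<close> the numbers \<open>\<langle>f\<^sub>i, K\<^sup>\<dagger> f\<^sub>i\<rangle>\<close> lie strictly below \<open>M\<close>, so for all
  small \<open>t > 0\<close> this dual is still optimal.

  The operators \<open>K\<^sup>\<dagger>\<close>, \<open>(K\<^sup>\<dagger>)\<^sup>1\<^sup>/\<^sup>2\<close> and the adjoint are given by definite descriptions, so their existence
  and uniqueness need proof. Apart from the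
  uniqueness of the pseudoinverse, which is plain algebra, it comes from the spectral theorem
  (\<open>symmetric_diagonalizable\<close>): a symmetric operator is diagonal in some orthonormal basis, and there
  pseudoinverse and square root are taken entry by entry. The spectral theorem is proved
  algebraically, uniformly for real and complex scalars: a polynomial of least degree that annihilates
  a nonzero vector has a linear or a real quadratic factor, and a symmetric operator makes the
  quadratic case impossible.
\<close>

section \<open>Scalars\<close>

lemma inj_to_complex: "inj (to_complex :: 'k::real_or_complex \<Rightarrow> complex)"
proof (rule injI)
  fix a b :: 'k assume eq: "to_complex a = to_complex b"
  have "to_complex b + to_complex (a - b) = to_complex (b + (a - b))"
    by (rule to_complex_add[symmetric])
  also have "b + (a - b) = a" by simp
  finally have "to_complex (a - b) = 0" unfolding eq by (simp only: add_cancel_left_right)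
  then have "norm (to_complex (a - b)) = 0" by simp
  then show "a = b" by (simp add: norm_to_complex)
qed

lemma to_complex_inject [simp]: "to_complex a = to_complex b \<longleftrightarrow> a = b"
  by (rule inj_eq[OF inj_to_complex])

lemma to_complex_0 [simp]: "to_complex (0::'k::real_or_complex) = 0"
proof -
  have "to_complex (0 + 0 :: 'k) = to_complex (0::'k) + to_complex (0::'k)"
    by (rule to_complex_add)
  then show ?thesis by (simp only: add_0_left add_cancel_right_right)
qed

lemma to_complex_1 [simp]: "to_complex (1::'k::real_or_complex) = 1"
proof -
  have "to_complex (1::'k) * to_complex (1::'k) = to_complex (1 * 1 :: 'k)"
    by (rule to_complex_mult[symmetric])
  then have "to_complex (1::'k) * to_complex (1::'k) = to_complex (1::'k)"
    by (simp only: mult_1)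
  moreover have "to_complex (1::'k) \<noteq> 0"
    using norm_to_complex[of "1::'k"] by auto
  ultimately show ?thesis by (metis mult_cancel_left1)
qed

lemma to_complex_minus [simp]: "to_complex (- a) = - to_complex a"
proof -
  have "to_complex (- a) + to_complex a = to_complex (- a + a)"
    by (rule to_complex_add[symmetric])
  then show ?thesis by (simp add: eq_neg_iff_add_eq_0)
qed

lemma to_complex_of_real [simp]: "to_complex (of_real r) = of_real r"
  unfolding of_real_def to_complex_scaleR by simp

lemma to_complex_conj [simp]: "to_complex (scalar_conj a) = cnj (to_complex a)"
proof -
  have "cnj (to_complex a) \<in> range (to_complex :: 'a \<Rightarrow> complex)"
    using range_to_complex[where 'a='a] by (metis Reals_cnj_iff UNIV_I complex_cnj_cnj rangeI)
  then obtain b :: 'a where "to_complex b = cnj (to_complex a)" by (metis rangeE)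
  then show ?thesis
    unfolding scalar_conj_def by (metis (mono_tags, lifting) theI to_complex_inject)
qed

lemma scalar_conj_simps [simp]:
  "scalar_conj (a + b) = scalar_conj a + scalar_conj b"
  "scalar_conj (a * b) = scalar_conj a * scalar_conj b"
  "scalar_conj (of_real r) = of_real r"
  "scalar_conj 0 = 0"
  "scalar_conj (scalar_conj a) = a"
  by (rule to_complex_inject[THEN iffD1], simp add: to_complex_add to_complex_mult)+

lemma mult_scalar_conj:
  fixes a :: "'k::real_or_complex"
  shows "a * scalar_conj a = of_real ((norm a)\<^sup>2)"
proof -
  have "to_complex (a * scalar_conj a) = to_complex (of_real ((norm a)\<^sup>2) :: 'k)"
    unfolding to_complex_mult to_complex_conj to_complex_of_real complex_norm_square[symmetric]
      norm_to_complex by simp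
  then show ?thesis unfolding to_complex_inject .
qed

lemma of_real_if_conj_fixed:
  fixes a :: "'k::real_or_complex"
  assumes "scalar_conj a = a"
  shows "a = of_real (Re (to_complex a))"
proof -
  have "cnj (to_complex a) = to_complex a" using assms to_complex_conj[of a] by simp
  then have "to_complex a = to_complex (of_real (Re (to_complex a)) :: 'k)"
    by (simp add: complex_eq_iff)
  then show ?thesis unfolding to_complex_inject .
qed

lemma poly_map_to_complex_add:
  "poly (map_poly to_complex (p + q)) z = poly (map_poly to_complex p) z + poly (map_poly to_complex q) z"
  by (induction p q rule: poly_induct2) (simp_all add: map_poly_pCons to_complex_add algebra_simps)

lemma poly_map_to_complex_smult:
  "poly (map_poly to_complex (smult a q)) z = to_complex a * poly (map_poly to_complex q) z"
  by (induction q) (simp_all add: map_poly_pCons to_complex_mult algebra_simps)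

lemma poly_map_to_complex_mult:
  "poly (map_poly to_complex (p * q)) z = poly (map_poly to_complex p) z * poly (map_poly to_complex q) z"
  by (induction p)
    (simp_all add: poly_map_to_complex_add poly_map_to_complex_smult map_poly_pCons algebra_simps)

text \<open>A complex root \<open>z\<close> exists by the fundamental theorem of algebra. If \<open>z\<close> is a scalar, it
  splits off linearly. Otherwise the scalars are the reals and \<open>z\<close> is not real; the remainder of \<open>p\<close>
  modulo the minimal polynomial of \<open>z\<close> is a real polynomial of degree at most 1 with the root \<open>z\<close>,
  hence zero.\<close>

lemma linear_or_quadratic_factor:
  fixes p :: "'k::real_or_complex poly"
  assumes deg: "degree p \<noteq> 0"
  obtains (linear) a where "[:- a, 1:] dvd p"
  | (quadratic) a b :: real where "b \<noteq> 0" "[:of_real (a\<^sup>2 + b\<^sup>2), of_real (- 2 * a), 1:] dvd p"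
proof -
  let ?P = "\<lambda>q. poly (map_poly to_complex q)"
  have deg': "degree (map_poly to_complex p) = degree p"
    by (rule degree_map_poly) (metis to_complex_0 to_complex_inject)
  have "\<exists>z. ?P p z = 0"
    using deg by (intro fundamental_theorem_of_algebra) (simp add: constant_degree deg')
  then obtain z where z: "?P p z = 0" ..
  show thesis
  proof (cases "z \<in> range (to_complex :: 'k \<Rightarrow> complex)")
    case True
    then obtain a :: 'k where a: "z = to_complex a" by auto
    have "?P q (to_complex a) = to_complex (poly q a)" for q
      by (induction q) (simp_all add: map_poly_pCons to_complex_add to_complex_mult)
    with z a have "poly p a = 0" by (metis to_complex_0 to_complex_inject)
    then show thesis by (auto simp: poly_eq_0_iff_dvd intro: linear)
  next
    case False
    with range_to_complex[where 'a='k] have R: "range (to_complex :: 'k \<Rightarrow> complex) = \<real>" by auto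
    with False have Im: "Im z \<noteq> 0" by (simp add: complex_is_Real_iff)
    define d :: "'k poly" where
      "d = [:of_real ((Re z)\<^sup>2 + (Im z)\<^sup>2), of_real (- 2 * Re z), 1:]"
    have "?P d z = of_real ((Re z)\<^sup>2 + (Im z)\<^sup>2) + z * (of_real (- 2 * Re z) + z * 1)"
      unfolding d_def
      by (simp only: map_poly_pCons to_complex_0 to_complex_1 to_complex_of_real
          poly_pCons map_poly_0 poly_0 mult_zero_right add_0_right)
    then have dz: "?P d z = 0"
      by (simp add: complex_eq_iff power2_eq_square algebra_simps)
    define r where "r = p mod d"
    have "?P (d * (p div d) + r) z = 0" using z by (simp add: r_def)
    then have rz: "?P r z = 0"
      by (simp add: poly_map_to_complex_add poly_map_to_complex_mult dz)
    have "degree d = 2" by (simp add: d_def)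
    moreover have "d \<noteq> 0" by (simp add: d_def)
    ultimately have "degree r \<le> 1"
      using degree_mod_less[of d p] by (auto simp: r_def)
    then have req: "r = [:coeff r 0, coeff r 1:]"
      by (intro poly_eqI) (auto simp: coeff_pCons coeff_eq_0 split: nat.split)
    have real: "Im (to_complex c) = 0" for c :: 'k
      using R by (metis complex_is_Real_iff rangeI)
    have eq: "to_complex (coeff r 0) + z * to_complex (coeff r 1) = 0"
      using rz by (subst (asm) req) (simp add: map_poly_pCons)
    have "Im z * Re (to_complex (coeff r 1)) = 0"
      using arg_cong[OF eq, of Im] by (simp add: real)
    with Im have c1: "to_complex (coeff r 1) = 0" by (simp add: complex_eq_iff real)
    with eq have "to_complex (coeff r 0) = 0" by simp
    with c1 have "r = 0" using req by (metis pCons_0_0 to_complex_0 to_complex_inject)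
    then have "d dvd p" by (simp add: r_def mod_eq_0_iff_dvd)
    then show thesis using Im unfolding d_def by (intro quadratic)
  qed
qed

section \<open>Inner products and symmetric operators\<close>

context finite_dim_hilbert
begin

lemma ip_add_right: "ip x (y + z) = ip x y + ip x z"
  by (metis ip_add ip_conj scalar_conj_simps(1))

lemma ip_scale_right: "ip x (scale a y) = scalar_conj a * ip x y"
  by (metis ip_conj ip_scale scalar_conj_simps(2))

lemma ip_0 [simp]: "ip 0 y = 0" "ip y 0 = 0"
  using ip_add[of 0 0 y] ip_add_right[of y 0 0] by simp_all

lemma ip_minus: "ip (- x) y = - ip x y" "ip x (- y) = - ip x y"
  using ip_add[of x "- x" y] ip_add_right[of x y "- y"]
  by (simp_all add: eq_neg_iff_add_eq_0 add.commute)

lemma ip_diff: "ip (x - y) z = ip x z - ip y z" "ip x (y - z) = ip x y - ip x z"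
  using ip_add[of x "- y" z] ip_add_right[of x y "- z"] by (simp_all add: ip_minus)

lemma ip_sum: "ip (sum g S) y = (\<Sum>i\<in>S. ip (g i) y)"
  by (induction S rule: infinite_finite_induct) (auto simp: ip_add)

lemma ip_sum_right: "ip y (sum g S) = (\<Sum>i\<in>S. ip y (g i))"
  by (induction S rule: infinite_finite_induct) (auto simp: ip_add_right)

lemma ip_self: "ip x x = of_real ((hnorm ip x)\<^sup>2)"
  using of_real_if_conj_fixed[OF ip_conj[symmetric], of x] ip_nonneg[of x]
  by (simp add: hnorm_def)

lemma hnorm_eq_0 [simp]: "hnorm ip x = 0 \<longleftrightarrow> x = 0"
  using ip_self[of x] ip_eq_0[of x] by (auto simp: hnorm_def)

lemma ip_eqI: "(\<And>y. ip x y = ip x' y) \<Longrightarrow> x = x'"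
  using ip_eq_0[of "x - x'"] by (simp add: ip_diff)

lemma ip_eqI_right: "(\<And>y. ip y x = ip y x') \<Longrightarrow> x = x'"
  using ip_eq_0[of "x - x'"] by (simp add: ip_diff)

abbreviation lin :: "('h \<Rightarrow> 'h) \<Rightarrow> bool" where
  "lin \<equiv> Vector_Spaces.linear scale scale"

lemma lin_iff: "lin A \<longleftrightarrow> (\<forall>x y. A (x + y) = A x + A y) \<and> (\<forall>c x. A (scale c x) = scale c (A x))"
  using vector_space_axioms by (simp add: Vector_Spaces.linear_iff)

lemma lin_0: "lin A \<Longrightarrow> A 0 = 0"
  unfolding lin_iff by (metis add_cancel_right_right)

lemma lin_sum: "lin A \<Longrightarrow> A (sum g S) = (\<Sum>i\<in>S. A (g i))"
  by (induction S rule: infinite_finite_induct) (auto simp: lin_0 lin_iff)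

definition symmetric_op :: "('h \<Rightarrow> 'h) \<Rightarrow> bool" where
  "symmetric_op A \<longleftrightarrow> (\<forall>x y. ip (A x) y = ip x (A y))"

lemma symmetric_opD: "symmetric_op A \<Longrightarrow> ip (A x) y = ip x (A y)"
  by (simp add: symmetric_op_def)

text \<open>Linearity of a symmetric operator can be moved to the other argument of the inner
  product, where nondegeneracy makes it automatic. Symmetry is used below in place of the adjoint,
  whose existence is itself a consequence of the spectral theorem.\<close>

lemma symmetric_op_lin:
  assumes "symmetric_op A"
  shows "lin A"
  unfolding lin_iff
  by (safe intro!: ip_eqI) (simp_all add: symmetric_opD[OF assms] ip_add ip_scale)

lemma finite_basis: obtains B where "finite B" "independent B" "span B = UNIV" "card B = dim UNIV"
proof -
  obtain C where C: "finite C" "span C = UNIV" using finite_dim by blast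
  obtain B where B: "B \<subseteq> UNIV" "independent B" "UNIV \<subseteq> span B"
    by (rule maximal_independent_subset)
  have "finite B" using independent_span_bound[OF C(1) B(2)] C by simp
  with B that show thesis by (metis basis_card_eq_dim top.extremum_unique)
qed

lemma independent_card_le_dim_UNIV:
  assumes "independent S"
  shows "finite S \<and> card S \<le> dim UNIV"
  by (metis assms finite_basis independent_span_bound subset_UNIV)

text \<open>The family may repeat vectors; a repetition is itself a relation.\<close>

lemma family_dependent:
  assumes I: "finite I" "card I > dim UNIV"
  obtains c where "\<exists>i\<in>I. c i \<noteq> 0" "(\<Sum>i\<in>I. scale (c i) (v i)) = 0"
proof (cases "inj_on v I")
  case True
  then have "dependent (v ` I)"
    using I independent_card_le_dim_UNIV[of "v ` I"] by (auto simp: card_image)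
  then obtain u where "\<exists>x\<in>v ` I. u x \<noteq> 0" "(\<Sum>x\<in>v ` I. scale (u x) x) = 0"
    using I(1) by (auto simp: dependent_finite)
  then show thesis using True by (intro that[of "u \<circ> v"]) (auto simp: sum.reindex)
next
  case False
  then obtain i j where ij: "i \<in> I" "j \<in> I" "i \<noteq> j" "v i = v j" by (auto simp: inj_on_def)
  let ?c = "\<lambda>k. if k = i then 1 else if k = j then - 1 else 0"
  have "(\<Sum>k\<in>I. scale (?c k) (v k)) = (\<Sum>k\<in>{i, j}. scale (?c k) (v k))"
    using ij I(1) by (intro sum.mono_neutral_right) auto
  also have "\<dots> = 0" using ij by simp
  finally show thesis using ij by (intro that[of ?c]) auto
qed

section \<open>The spectral theorem\<close>

text \<open>The vector \<open>p(A) y\<close>, evaluated by the Horner scheme.\<close>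

definition poly_op :: "('h \<Rightarrow> 'h) \<Rightarrow> 'k poly \<Rightarrow> 'h \<Rightarrow> 'h" where
  "poly_op A p y = fold_coeffs (\<lambda>a v. scale a y + A v) p 0"

lemma poly_op_0 [simp]: "poly_op A 0 y = 0"
  by (simp add: poly_op_def)

lemma poly_op_pCons [simp]:
  "lin A \<Longrightarrow> poly_op A (pCons a p) y = scale a y + A (poly_op A p y)"
  by (cases "p = 0"; cases "a = 0") (simp_all add: poly_op_def lin_0)

lemma poly_op_add:
  assumes "lin A"
  shows "poly_op A (p + q) y = poly_op A p y + poly_op A q y"
  using assms
  by (induction p q rule: poly_induct2) (simp_all add: lin_iff scale_left_distrib)

lemma poly_op_smult:
  assumes "lin A"
  shows "poly_op A (smult c p) y = scale c (poly_op A p y)"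
  using assms by (induction p) (simp_all add: lin_iff scale_right_distrib)

lemma poly_op_mult:
  assumes "lin A"
  shows "poly_op A (p * q) y = poly_op A p (poly_op A q y)"
  using assms by (induction p) (simp_all add: poly_op_add poly_op_smult)

lemma poly_op_sum:
  assumes "lin A"
  shows "poly_op A (sum g S) y = (\<Sum>i\<in>S. poly_op A (g i) y)"
  by (induction S rule: infinite_finite_induct) (simp_all add: poly_op_add assms)

lemma poly_op_monom:
  assumes "lin A"
  shows "poly_op A (monom c n) y = scale c ((A ^^ n) y)"
  using assms by (induction n) (simp_all add: monom_0 monom_Suc lin_iff lin_0)

lemma poly_op_in_subspace:
  assumes "lin A" "subspace V" "A ` V \<subseteq> V" "y \<in> V"
  shows "poly_op A p y \<in> V"
  using assms by (induction p) (auto simp: subspace_def)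

text \<open>The iterates \<open>A\<^sup>i y\<close> for \<open>i \<le> dim\<close> are one too many to be independent.\<close>

lemma annihilating_poly:
  assumes "lin A"
  obtains p where "p \<noteq> 0" "poly_op A p y = 0"
proof -
  obtain c where c: "\<exists>i\<in>{..dim UNIV}. c i \<noteq> 0"
      "(\<Sum>i\<in>{..dim UNIV}. scale (c i) ((A ^^ i) y)) = 0"
    by (rule family_dependent[of "{..dim UNIV}" "\<lambda>i. (A ^^ i) y"]) auto
  let ?p = "\<Sum>i\<le>dim UNIV. monom (c i) i"
  have "coeff ?p i = c i" if "i \<le> dim UNIV" for i
    using that by (simp add: coeff_sum)
  with c(1) have "?p \<noteq> 0" by (metis atMost_iff coeff_0)
  moreover have "poly_op A ?p y = 0"
    using c(2) by (simp add: poly_op_sum poly_op_monom assms)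
  ultimately show thesis by (rule that)
qed

text \<open>The polynomial is \<open>(X - a)\<^sup>2 + b\<^sup>2\<close>. With the symmetric operator \<open>D = A - a\<close>,
  pairing \<open>D\<^sup>2 w + b\<^sup>2 w = 0\<close> with \<open>w\<close> gives \<open>\<parallel>D w\<parallel>\<^sup>2 + b\<^sup>2 \<parallel>w\<parallel>\<^sup>2 = 0\<close>.\<close>

lemma symmetric_quadratic_injective:
  assumes sym: "symmetric_op A" and b: "b \<noteq> 0"
    and w: "poly_op A [:of_real (a\<^sup>2 + b\<^sup>2), of_real (- 2 * a), 1:] w = 0"
  shows "w = 0"
proof -
  have lin: "lin A" by (rule symmetric_op_lin[OF sym])
  define D where "D x = A x - scale (of_real a) x" for x
  have D: "ip (D x) y = ip x (D y)" for x y
    by (simp add: D_def ip_diff ip_scale ip_scale_right symmetric_opD[OF sym])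
  have A_diff: "A (x - y) = A x - A y" for x y
    using lin unfolding lin_iff by (metis add_diff_cancel diff_add_cancel)
  have "D (D w) = A (A w) - scale (of_real a) (A w) - (scale (of_real a) (A w) - scale (of_real (a\<^sup>2)) w)"
    using lin by (simp add: D_def A_diff lin_iff scale_right_diff_distrib power2_eq_square)
  moreover have "A (A w) = scale (of_real a) (A w) + scale (of_real a) (A w)
      - (scale (of_real (a\<^sup>2)) w + scale (of_real (b\<^sup>2)) w)"
  proof -
    have "scale (of_real (a\<^sup>2)) w + scale (of_real (b\<^sup>2)) w + (scale (of_real (- 2 * a)) (A w) + A (A w)) = 0"
      using w lin by (simp add: lin_0 lin_iff scale_left_distrib A_diff)
    moreover have "scale (of_real (- 2 * a)) (A w) = - (scale (of_real a) (A w) + scale (of_real a) (A w))"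
      by (simp flip: scale_left_distrib scale_minus_left)
    ultimately show ?thesis by (simp add: algebra_simps eq_neg_iff_add_eq_0)
  qed
  ultimately have "D (D w) + scale (of_real (b\<^sup>2)) w = 0"
    by (simp add: algebra_simps)
  then have "ip (D (D w) + scale (of_real (b\<^sup>2)) w) w = 0" by simp
  then have "(of_real ((hnorm ip (D w))\<^sup>2 + b\<^sup>2 * (hnorm ip w)\<^sup>2) :: 'k) = 0"
    by (simp add: ip_add ip_scale D ip_self)
  then have "(hnorm ip (D w))\<^sup>2 + b\<^sup>2 * (hnorm ip w)\<^sup>2 = 0" unfolding of_real_eq_0_iff .
  then have "b\<^sup>2 * (hnorm ip w)\<^sup>2 = 0"
    by (simp add: add_nonneg_eq_0_iff)
  with b show ?thesis by simp
qed

text \<open>Let \<open>p\<close> be a nonzero polynomial of least degree with \<open>p(A) y = 0\<close>. A factorisation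
  \<open>p = d q\<close> with \<open>d\<close> not constant has \<open>q(A) y \<noteq> 0\<close>, and this vector lies in the kernel of \<open>d(A)\<close>. For
  linear \<open>d\<close> it is an eigenvector, whose eigenvalue is real by symmetry.\<close>

lemma symmetric_eigenvector_in_subspace:
  assumes sym: "symmetric_op A" and V: "subspace V" "A ` V \<subseteq> V" and y: "y \<in> V" "y \<noteq> 0"
  obtains w r where "w \<in> V" "w \<noteq> 0" "A w = scale (of_real r) w"
proof -
  have lin: "lin A" by (rule symmetric_op_lin[OF sym])
  let ?Q = "\<lambda>p. p \<noteq> 0 \<and> poly_op A p y = 0"
  obtain p0 where "?Q p0" using annihilating_poly[OF lin] by blast
  then obtain p where p: "?Q p" and min: "\<And>q. ?Q q \<Longrightarrow> degree p \<le> degree q"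
    using ex_has_least_nat[of ?Q p0 degree] by blast
  have deg: "degree p \<noteq> 0"
  proof
    assume "degree p = 0"
    then obtain a where "p = [:a:]" by (rule degree_eq_zeroE)
    with p y(2) show False by (auto simp: lin lin_0)
  qed
  have key: "\<exists>w\<in>V. w \<noteq> 0 \<and> poly_op A d w = 0" if d: "d dvd p" "degree d > 0" for d
  proof -
    obtain q where q: "p = d * q" using d(1) by (elim dvdE)
    with p have nz: "d \<noteq> 0" "q \<noteq> 0" by auto
    then have "degree q < degree p" using d(2) by (simp add: q degree_mult_eq)
    with min[of q] nz have "poly_op A q y \<noteq> 0" by auto
    moreover have "poly_op A d (poly_op A q y) = 0" using p q by (simp add: poly_op_mult lin)
    ultimately show ?thesis using poly_op_in_subspace[OF lin V y(1), of q] by blast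
  qed
  from deg show thesis
  proof (cases rule: linear_or_quadratic_factor)
    case (linear a)
    from key[OF linear] obtain w where w: "w \<in> V" "w \<noteq> 0" "poly_op A [:- a, 1:] w = 0" by auto
    have Aw: "A w = scale a w"
      using w(3) lin by (simp add: lin_0)
    have "a * ip w w = scalar_conj a * ip w w"
      using symmetric_opD[OF sym, of w w] by (simp add: Aw ip_scale ip_scale_right)
    with w(2) have "scalar_conj a = a" by (simp add: ip_eq_0)
    then have "a = of_real (Re (to_complex a))" by (rule of_real_if_conj_fixed)
    with w Aw that show thesis by metis
  next
    case (quadratic a b)
    from key[OF quadratic(2)] obtain w where "w \<in> V" "w \<noteq> 0"
      "poly_op A [:of_real (a\<^sup>2 + b\<^sup>2), of_real (- 2 * a), 1:] w = 0" by fastforce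
    with symmetric_quadratic_injective[OF sym quadratic(1)] show thesis by blast
  qed
qed

definition orthonormal :: "'h set \<Rightarrow> bool" where
  "orthonormal B \<longleftrightarrow> (\<forall>a\<in>B. \<forall>b\<in>B. ip a b = (if a = b then 1 else 0))"

definition orthonormal_basis :: "'h set \<Rightarrow> bool" where
  "orthonormal_basis B \<longleftrightarrow> finite B \<and> orthonormal B \<and> (\<forall>x. (\<Sum>e\<in>B. scale (ip x e) e) = x)"

lemma ip_orthonormal_sum:
  assumes "orthonormal B" "finite B" "e \<in> B"
  shows "ip (\<Sum>b\<in>B. scale (c b) b) e = c e"
proof -
  have "ip (\<Sum>b\<in>B. scale (c b) b) e = (\<Sum>b\<in>B. if b = e then c b else 0)"
    unfolding ip_sum using assms by (intro sum.cong) (auto simp: orthonormal_def ip_scale)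
  then show ?thesis using assms by simp
qed

lemma orthonormal_independent:
  assumes "orthonormal B"
  shows "independent B"
  unfolding independent_explicit_module
proof (intro allI impI)
  fix t u v assume t: "finite t" "t \<subseteq> B" and 0: "(\<Sum>v\<in>t. scale (u v) v) = 0" and v: "v \<in> t"
  have "orthonormal t" using assms t by (auto simp: orthonormal_def subset_iff)
  from ip_orthonormal_sum[OF this t(1) v, of u] 0 show "u v = 0" by simp
qed

definition diag_op :: "'h set \<Rightarrow> ('h \<Rightarrow> real) \<Rightarrow> 'h \<Rightarrow> 'h" where
  "diag_op B l x = (\<Sum>e\<in>B. scale (of_real (l e) * ip x e) e)"

lemma eq_diag_op:
  assumes B: "orthonormal_basis B" and lin: "lin A"
    and eig: "\<And>e. e \<in> B \<Longrightarrow> A e = scale (of_real (l e)) e"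
  shows "A = diag_op B l"
proof
  fix x
  have "A x = A (\<Sum>e\<in>B. scale (ip x e) e)" using B by (simp add: orthonormal_basis_def)
  also have "\<dots> = (\<Sum>e\<in>B. scale (ip x e) (A e))"
    using lin by (simp add: lin_sum lin_iff)
  also have "\<dots> = diag_op B l x"
    unfolding diag_op_def by (intro sum.cong) (auto simp: eig mult.commute)
  finally show "A x = diag_op B l x" .
qed

text \<open>A largest orthonormal set of eigenvectors is a basis: its orthogonal complement is
  invariant, so if nonzero it would contain a further eigenvector.\<close>

theorem symmetric_diagonalizable:
  assumes sym: "symmetric_op A"
  obtains B l where "orthonormal_basis B" "A = diag_op B l"
proof -
  have lin: "lin A" by (rule symmetric_op_lin[OF sym])
  let ?Q = "\<lambda>B. orthonormal B \<and> (\<forall>e\<in>B. \<exists>r. A e = scale (of_real r) e)"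
  have "?Q {}" by (simp add: orthonormal_def)
  moreover have "\<forall>B. ?Q B \<longrightarrow> card B < Suc (dim UNIV)"
    using independent_card_le_dim_UNIV orthonormal_independent by (simp add: less_Suc_eq_le)
  ultimately have "\<exists>B. ?Q B \<and> (\<forall>C. ?Q C \<longrightarrow> card C \<le> card B)"
    by (rule ex_has_greatest_nat)
  then obtain B where B: "?Q B" and max: "\<And>C. ?Q C \<Longrightarrow> card C \<le> card B" by blast
  have on: "orthonormal B" and fin: "finite B"
    using B orthonormal_independent independent_card_le_dim_UNIV by auto
  have "orthonormal_basis B"
  proof (rule ccontr)
    assume "\<not> orthonormal_basis B"
    then obtain x where x: "(\<Sum>e\<in>B. scale (ip x e) e) \<noteq> x"
      using on fin by (auto simp: orthonormal_basis_def)
    define V where "V = {y. \<forall>e\<in>B. ip y e = 0}"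
    have "subspace V" by (auto simp: V_def subspace_def ip_add ip_scale)
    moreover have "A ` V \<subseteq> V"
    proof (clarsimp simp: V_def)
      fix y e assume y: "\<forall>e\<in>B. ip y e = 0" and e: "e \<in> B"
      obtain r where "A e = scale (of_real r) e" using B e by blast
      with y e show "ip (A y) e = 0"
        by (simp add: symmetric_opD[OF sym] ip_scale_right)
    qed
    moreover have "x - (\<Sum>e\<in>B. scale (ip x e) e) \<in> V"
      by (auto simp: V_def ip_diff ip_orthonormal_sum[OF on fin])
    moreover have "x - (\<Sum>e\<in>B. scale (ip x e) e) \<noteq> 0" using x by simp
    ultimately obtain w r where w: "w \<in> V" "w \<noteq> 0" "A w = scale (of_real r) w"
      by (rule symmetric_eigenvector_in_subspace[OF sym])
    define e where "e = scale (of_real (inverse (hnorm ip w))) w"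
    have "ip e e = of_real (inverse (hnorm ip w)) * (of_real (inverse (hnorm ip w)) * ip w w)"
      by (simp only: e_def ip_scale ip_scale_right scalar_conj_simps)
    also have "\<dots> = 1"
      using w(2) unfolding ip_self[of w] by (simp add: power2_eq_square field_simps)
    finally have ee: "ip e e = 1" .
    have eB: "ip e b = 0" "ip b e = 0" if "b \<in> B" for b
    proof -
      show *: "ip e b = 0" using w(1) that by (simp add: e_def V_def ip_scale)
      show "ip b e = 0" using ip_conj[of b e] * by simp
    qed
    have "e \<notin> B" using ee eB by force
    have "A e = scale (of_real r) e"
      using lin by (simp add: e_def lin_iff w(3) mult.commute)
    with B have "?Q (insert e B)"
      using ee eB by (auto simp: orthonormal_def)
    from max[OF this] \<open>e \<notin> B\<close> fin show False by simp
  qed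
  moreover from B have "\<forall>e\<in>B. \<exists>r. A e = scale (of_real r) e" by (rule conjunct2)
  then obtain l where l: "\<forall>e\<in>B. A e = scale (of_real (l e)) e" by (rule bchoice[elim_format]) blast
  ultimately have "A = diag_op B l" using l by (intro eq_diag_op lin) auto
  with \<open>orthonormal_basis B\<close> show thesis by (rule that)
qed

text \<open>The spectral theorem for the identity operator.\<close>

lemma orthonormal_basis_exists: obtains B where "orthonormal_basis B"
  using symmetric_diagonalizable[of "\<lambda>x. x"] by (auto simp: symmetric_op_def)

lemma ip_diag_op:
  "ip (diag_op B l x) y = (\<Sum>e\<in>B. of_real (l e) * ip x e * ip e y)"
  by (simp add: diag_op_def ip_sum ip_scale)

lemma ip_diag_op_basis:
  assumes "orthonormal_basis B" "e \<in> B"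
  shows "ip (diag_op B l x) e = of_real (l e) * ip x e"
  using assms unfolding diag_op_def orthonormal_basis_def by (simp add: ip_orthonormal_sum)

lemma diag_op_basis:
  assumes "orthonormal_basis B" "e \<in> B"
  shows "diag_op B l e = scale (of_real (l e)) e"
proof -
  have "diag_op B l e = (\<Sum>b\<in>B. if b = e then scale (of_real (l e)) e else 0)"
    unfolding diag_op_def using assms
    by (intro sum.cong) (auto simp: orthonormal_basis_def orthonormal_def)
  then show ?thesis using assms by (simp add: orthonormal_basis_def)
qed

lemma symmetric_diag_op: "symmetric_op (diag_op B l)"
  unfolding symmetric_op_def diag_op_def
proof (intro allI)
  fix x y
  have "scalar_conj (ip y e) = ip e y" for e by (rule ip_conj[symmetric])
  then show "ip (\<Sum>e\<in>B. scale (of_real (l e) * ip x e) e) y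
      = ip x (\<Sum>e\<in>B. scale (of_real (l e) * ip y e) e)"
    by (simp add: ip_sum ip_sum_right ip_scale ip_scale_right mult_ac)
qed

lemma diag_op_comp:
  assumes "orthonormal_basis B"
  shows "diag_op B l \<circ> diag_op B m = diag_op B (\<lambda>e. l e * m e)"
  by (rule ext) (simp add: diag_op_def[of B l] diag_op_def[of B "\<lambda>e. l e * m e"]
      ip_diag_op_basis[OF assms] mult.assoc)

lemma diag_op_cong: "(\<And>e. e \<in> B \<Longrightarrow> l e = m e) \<Longrightarrow> diag_op B l = diag_op B m"
  by (simp add: diag_op_def fun_eq_iff)

section \<open>Adjoints, pseudoinverses and square roots\<close>

lemma hadjoint_eqI:
  assumes "\<And>x y. ip (A x) y = ip x (B y)"
  shows "hadjoint ip A = B"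
  unfolding hadjoint_def
proof (rule the_equality)
  fix C assume C: "\<forall>x y. ip (A x) y = ip x (C y)"
  show "C = B"
    by (intro ext ip_eqI_right) (use C assms in metis)
qed (use assms in blast)

text \<open>In an orthonormal basis the adjoint is \<open>y \<mapsto> \<Sum> \<langle>y, A e\<rangle> e\<close>.\<close>

lemma ip_hadjoint:
  assumes lin: "lin A"
  shows "ip (A x) y = ip x (hadjoint ip A y)"
proof -
  obtain B where B: "orthonormal_basis B" by (rule orthonormal_basis_exists)
  define C where "C y = (\<Sum>e\<in>B. scale (ip y (A e)) e)" for y
  have C: "ip (A x) y = ip x (C y)" for x y
  proof -
    have conj: "scalar_conj (ip y (A e)) = ip (A e) y" for e by (rule ip_conj[symmetric])
    have "ip (A x) y = ip (A (\<Sum>e\<in>B. scale (ip x e) e)) y" using B by (simp add: orthonormal_basis_def)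
    also have "\<dots> = (\<Sum>e\<in>B. ip x e * ip (A e) y)"
      using lin by (simp add: lin_sum lin_iff ip_sum ip_scale)
    also have "\<dots> = ip x (C y)"
      by (simp add: C_def ip_sum_right ip_scale_right conj mult.commute)
    finally show ?thesis .
  qed
  then show ?thesis by (simp add: hadjoint_eqI[OF C])
qed

lemma hadjoint_fixed_iff: "lin A \<Longrightarrow> hadjoint ip A = A \<longleftrightarrow> symmetric_op A"
  by (metis hadjoint_eqI ip_hadjoint symmetric_op_def)

lemma positive_semidef_iff:
  "positive_semidef scale ip A \<longleftrightarrow> symmetric_op A \<and> (\<forall>x. 0 \<le> Re (to_complex (ip (A x) x)))"
  unfolding positive_semidef_def using hadjoint_fixed_iff symmetric_op_lin by blast

lemma positive_diag_op_iff:
  assumes B: "orthonormal_basis B"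
  shows "positive_semidef scale ip (diag_op B l) \<longleftrightarrow> (\<forall>e\<in>B. 0 \<le> l e)"
proof
  assume pos: "positive_semidef scale ip (diag_op B l)"
  show "\<forall>e\<in>B. 0 \<le> l e"
  proof
    fix e assume e: "e \<in> B"
    then have "ip e e = 1" using B by (auto simp: orthonormal_basis_def orthonormal_def)
    then have "ip (diag_op B l e) e = of_real (l e)"
      by (simp add: diag_op_basis[OF B e] ip_scale)
    then have "Re (to_complex (ip (diag_op B l e) e)) = l e" by simp
    with pos show "0 \<le> l e" unfolding positive_semidef_iff by metis
  qed
next
  assume l: "\<forall>e\<in>B. 0 \<le> l e"
  have "0 \<le> Re (to_complex (ip (diag_op B l x) x))" for x
  proof -
    have "ip x e * ip e x = of_real ((norm (ip x e))\<^sup>2)" for e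
      unfolding mult_scalar_conj[symmetric] ip_conj[of e x] ..
    then have "ip (diag_op B l x) x = of_real (\<Sum>e\<in>B. l e * (norm (ip x e))\<^sup>2)"
      by (simp add: ip_diag_op mult.assoc)
    then show ?thesis using l by (simp add: sum_nonneg del: of_real_sum)
  qed
  then show "positive_semidef scale ip (diag_op B l)"
    by (simp add: positive_semidef_iff symmetric_diag_op)
qed

text \<open>The predicate under the definite description that defines \<open>mp_inverse\<close>.\<close>

definition penrose :: "('h \<Rightarrow> 'h) \<Rightarrow> ('h \<Rightarrow> 'h) \<Rightarrow> bool" where
  "penrose A X \<longleftrightarrow> lin X \<and> A \<circ> X \<circ> A = A \<and> X \<circ> A \<circ> X = X \<and>
     hadjoint ip (A \<circ> X) = A \<circ> X \<and> hadjoint ip (X \<circ> A) = X \<circ> A"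

text \<open>For symmetric products, \<open>AX = (AY)(AX)\<close> and its adjoint give \<open>AX = (AX)(AY) = AY\<close>;
  likewise \<open>XA = YA\<close>. Then \<open>X = XAX = XAY = YAY = Y\<close>.\<close>

lemma penrose_unique:
  assumes A: "lin A" and X: "penrose A X" and Y: "penrose A Y"
  shows "X = Y"
proof -
  have lin: "lin (A \<circ> Z)" "lin (Z \<circ> A)" if "penrose A Z" for Z
  proof -
    have "lin Z" using that by (simp only: penrose_def)
    with A show "lin (A \<circ> Z)" "lin (Z \<circ> A)" by (simp_all add: lin_iff)
  qed
  have AX: "symmetric_op (A \<circ> X)" "symmetric_op (X \<circ> A)"
    and AY: "symmetric_op (A \<circ> Y)" "symmetric_op (Y \<circ> A)"
    using X Y hadjoint_fixed_iff[OF lin(1)] hadjoint_fixed_iff[OF lin(2)]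
    unfolding penrose_def by blast+
  have X1: "A (X (A u)) = A u" "X (A (X u)) = X u" and Y1: "A (Y (A u)) = A u" "Y (A (Y u)) = Y u" for u
    using X Y unfolding penrose_def fun_eq_iff comp_apply by blast+
  have 1: "A (X u) = A (Y u)" for u
  proof (rule ip_eqI)
    fix v
    have "ip (A (X u)) v = ip u (A (X v))" using symmetric_opD[OF AX(1), of u v] by simp
    also have "\<dots> = ip u (A (Y (A (X v))))" by (simp add: Y1)
    also have "\<dots> = ip (A (Y u)) (A (X v))" using symmetric_opD[OF AY(1), of u] by simp
    also have "\<dots> = ip (A (X (A (Y u)))) v" using symmetric_opD[OF AX(1), of _ v] by simp
    finally show "ip (A (X u)) v = ip (A (Y u)) v" by (simp add: X1)
  qed
  have 2: "X (A u) = Y (A u)" for u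
  proof (rule ip_eqI)
    fix v
    have "ip (X (A u)) v = ip (X (A (Y (A u)))) v" by (simp add: Y1)
    also have "\<dots> = ip (Y (A u)) (X (A v))" using symmetric_opD[OF AX(2), of _ v] by simp
    also have "\<dots> = ip u (Y (A (X (A v))))" using symmetric_opD[OF AY(2), of u] by simp
    also have "\<dots> = ip u (Y (A v))" by (simp add: X1)
    also have "\<dots> = ip (Y (A u)) v" using symmetric_opD[OF AY(2), of u v] by simp
    finally show "ip (X (A u)) v = ip (Y (A u)) v" .
  qed
  show ?thesis
  proof
    fix u
    have "X u = X (A (X u))" by (simp add: X1)
    also have "\<dots> = Y (A (Y u))" by (simp add: 1 2)
    finally show "X u = Y u" by (simp add: Y1)
  qed
qed

text \<open>The convention \<open>inverse 0 = 0\<close> is exactly what the kernel directions require.\<close>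

lemma mp_inverse_diag_op:
  assumes B: "orthonormal_basis B"
  shows "mp_inverse scale ip (diag_op B l) = diag_op B (\<lambda>e. inverse (l e))"
proof -
  let ?A = "diag_op B l" and ?X = "diag_op B (\<lambda>e. inverse (l e))"
  have lin: "lin ?A" by (rule symmetric_op_lin[OF symmetric_diag_op])
  have sym: "hadjoint ip (diag_op B m) = diag_op B m" for m
    using hadjoint_fixed_iff symmetric_diag_op symmetric_op_lin by blast
  have inv: "(\<lambda>e. l e * inverse (l e) * l e) = l"
       "(\<lambda>e. inverse (l e) * l e * inverse (l e)) = (\<lambda>e. inverse (l e))"
    by (simp_all add: fun_eq_iff field_simps)
  have "penrose ?A ?X"
    unfolding penrose_def diag_op_comp[OF B] inv
    by (simp add: sym symmetric_op_lin symmetric_diag_op)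
  then have "(THE X. penrose ?A X) = ?X"
    using penrose_unique[OF lin] by blast
  then show ?thesis unfolding mp_inverse_def penrose_def .
qed

text \<open>Let \<open>S e = s e\<close> and let \<open>c\<close> run through an eigenbasis of \<open>T\<close> with eigenvalues \<open>t\<^sub>c\<close>.
  Comparing the \<open>c\<close>-coordinates of \<open>S\<^sup>2 e = T\<^sup>2 e\<close> shows \<open>t\<^sub>c\<^sup>2 = s\<^sup>2\<close>, hence \<open>t\<^sub>c = s\<close>, wherever \<open>e\<close> has a
  nonzero coordinate. So \<open>T e = s e\<close>, and \<open>S\<close>, \<open>T\<close> agree on an eigenbasis of \<open>S\<close>.\<close>

lemma positive_sqrt_unique:
  assumes S: "positive_semidef scale ip S" and T: "positive_semidef scale ip T"
    and eq: "S \<circ> S = T \<circ> T"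
  shows "S = T"
proof -
  have sym: "symmetric_op S" "symmetric_op T" using S T by (simp_all add: positive_semidef_iff)
  obtain B s where B: "orthonormal_basis B" and Sd: "S = diag_op B s"
    using sym(1) by (rule symmetric_diagonalizable)
  obtain C t where C: "orthonormal_basis C" and Td: "T = diag_op C t"
    using sym(2) by (rule symmetric_diagonalizable)
  have s: "\<forall>e\<in>B. 0 \<le> s e" and t: "\<forall>c\<in>C. 0 \<le> t c"
    using S T Sd Td positive_diag_op_iff B C by auto
  have "T e = scale (of_real (s e)) e" if e: "e \<in> B" for e
  proof -
    have *: "of_real (t c) * ip e c = of_real (s e) * ip e c" if c: "c \<in> C" for c
    proof (cases "ip e c = 0")
      case False
      have "of_real ((s e)\<^sup>2) * ip e c = ip ((S \<circ> S) e) c"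
        by (simp add: Sd diag_op_comp[OF B] diag_op_basis[OF B e] ip_scale power2_eq_square del: comp_apply)
      also have "\<dots> = of_real ((t c)\<^sup>2) * ip e c"
        unfolding eq by (simp add: Td diag_op_comp[OF C] ip_diag_op_basis[OF C c] power2_eq_square del: comp_apply)
      finally have "(s e)\<^sup>2 = (t c)\<^sup>2"
        using False by (simp del: of_real_power)
      then show ?thesis using s t e c by (simp add: power2_eq_iff_nonneg)
    qed simp
    have "T e = (\<Sum>c\<in>C. scale (of_real (s e)) (scale (ip e c) c))"
      unfolding Td diag_op_def by (intro sum.cong) (auto simp: *)
    also have "\<dots> = scale (of_real (s e)) e"
      using C by (simp only: scale_sum_right[symmetric] orthonormal_basis_def)
    finally show ?thesis .
  qed
  from eq_diag_op[OF B symmetric_op_lin[OF sym(2)] this] show ?thesis using Sd by simp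
qed

lemma op_sqrt:
  assumes "positive_semidef scale ip A"
  shows "positive_semidef scale ip (op_sqrt scale ip A)"
    and "op_sqrt scale ip A \<circ> op_sqrt scale ip A = A"
proof -
  obtain B l where B: "orthonormal_basis B" and A: "A = diag_op B l"
    using assms by (auto simp: positive_semidef_iff elim: symmetric_diagonalizable)
  have l: "\<forall>e\<in>B. 0 \<le> l e" using assms A positive_diag_op_iff[OF B] by auto
  let ?S = "diag_op B (\<lambda>e. sqrt (l e))"
  have "positive_semidef scale ip ?S" by (simp add: positive_diag_op_iff[OF B] l)
  moreover have "?S \<circ> ?S = A"
    unfolding A diag_op_comp[OF B] by (rule diag_op_cong) (simp add: l)
  ultimately have "\<exists>!S. positive_semidef scale ip S \<and> S \<circ> S = A"
    using positive_sqrt_unique by blast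
  from theI'[OF this] show "positive_semidef scale ip (op_sqrt scale ip A)"
    and "op_sqrt scale ip A \<circ> op_sqrt scale ip A = A"
    unfolding op_sqrt_def by auto
qed

lemma hnorm_op_sqrt:
  assumes "positive_semidef scale ip A"
  shows "ip x (A x) = of_real ((hnorm ip (op_sqrt scale ip A x))\<^sup>2)"
proof -
  let ?S = "op_sqrt scale ip A"
  have "symmetric_op ?S" using op_sqrt(1)[OF assms] by (simp add: positive_semidef_iff)
  moreover have "A x = ?S (?S x)" using op_sqrt(2)[OF assms] by (metis comp_apply)
  ultimately show ?thesis by (metis ip_self symmetric_opD)
qed

lemma mp_inverse_positive:
  assumes K: "positive_semidef scale ip K"
  shows "positive_semidef scale ip (mp_inverse scale ip K)"
    and "K (K (mp_inverse scale ip K x)) = K x"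
proof -
  obtain B l where B: "orthonormal_basis B" and Kd: "K = diag_op B l"
    using K by (auto simp: positive_semidef_iff elim: symmetric_diagonalizable)
  have l: "\<forall>e\<in>B. 0 \<le> l e" using K Kd positive_diag_op_iff[OF B] by auto
  let ?X = "diag_op B (\<lambda>e. inverse (l e))"
  have X: "mp_inverse scale ip K = ?X" using Kd mp_inverse_diag_op[OF B] by simp
  show "positive_semidef scale ip (mp_inverse scale ip K)"
    unfolding X by (simp add: positive_diag_op_iff[OF B] l)
  have inv: "(\<lambda>e. l e * (l e * inverse (l e))) = l" by (simp add: fun_eq_iff field_simps)
  have "K \<circ> (K \<circ> ?X) = K" unfolding Kd diag_op_comp[OF B] inv ..
  then show "K (K (mp_inverse scale ip K x)) = K x" unfolding X by (metis comp_apply)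
qed

section \<open>Parseval frames and their duals\<close>

text \<open>Polarisation with the vectors \<open>x\<close> and \<open>T x\<close>; symmetry makes both cross terms equal
  to \<open>\<parallel>T x\<parallel>\<^sup>2\<close>, so the argument works over the reals as well.\<close>

lemma symmetric_zero_form:
  assumes sym: "symmetric_op T" and 0: "\<And>x. ip (T x) x = 0"
  shows "T x = 0"
proof -
  have T_add: "T (u + v) = T u + T v" for u v
    using symmetric_op_lin[OF sym] by (simp add: lin_iff)
  have "ip (T (x + T x)) (x + T x) = 2 * ip (T x) (T x)"
    by (simp add: T_add ip_add ip_add_right 0 symmetric_opD[OF sym, of "T x" x])
  with 0[of "x + T x"] show ?thesis by (simp add: ip_eq_0)
qed

text \<open>The frame operator and \<open>K\<^sup>2\<close> are symmetric, and the Parseval identity says that they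
  have the same quadratic form.\<close>

lemma parseval_frame_operator:
  fixes f :: "'i::finite \<Rightarrow> 'h"
  assumes sym: "symmetric_op K" and frame: "parseval_K_frame ip K f"
  shows "(\<Sum>i\<in>UNIV. scale (ip x (f i)) (f i)) = K (K x)"
proof -
  have K: "hadjoint ip K = K" using sym hadjoint_fixed_iff symmetric_op_lin by blast
  define T where "T x = (\<Sum>i\<in>UNIV. scale (ip x (f i)) (f i)) - K (K x)" for x
  have conj: "scalar_conj (ip y (f i)) = ip (f i) y" for y i by (rule ip_conj[symmetric])
  have "symmetric_op T"
    unfolding symmetric_op_def T_def
    by (simp add: ip_diff ip_sum ip_sum_right ip_scale ip_scale_right conj symmetric_opD[OF sym] mult.commute)
  moreover have "ip (T x) x = 0" for x
  proof -
    have "ip x (f i) * ip (f i) x = of_real ((norm (ip x (f i)))\<^sup>2)" for i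
      by (simp only: mult_scalar_conj[symmetric] conj)
    then have "ip (\<Sum>i\<in>UNIV. scale (ip x (f i)) (f i)) x = of_real (\<Sum>i\<in>UNIV. (norm (ip x (f i)))\<^sup>2)"
      by (simp add: ip_sum ip_scale)
    also have "\<dots> = of_real ((hnorm ip (K x))\<^sup>2)"
      using frame by (simp only: parseval_K_frame_def K)
    also have "\<dots> = ip (K (K x)) x"
      by (simp only: ip_self[symmetric] symmetric_opD[OF sym, of "K x" x])
    finally show ?thesis by (simp add: T_def ip_diff)
  qed
  ultimately have "T x = 0" by (rule symmetric_zero_form)
  then show ?thesis by (simp add: T_def)
qed

lemma canonical_K_dual_is_K_dual:
  fixes f :: "'i::finite \<Rightarrow> 'h"
  assumes K: "positive_semidef scale ip K" and frame: "parseval_K_frame ip K f"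
  shows "K_dual scale ip K f (canonical_K_dual scale ip K f)"
proof -
  let ?X = "mp_inverse scale ip K"
  have sym: "symmetric_op ?X" "symmetric_op K"
    using mp_inverse_positive(1)[OF K] K by (simp_all add: positive_semidef_iff)
  have "(\<Sum>i\<in>UNIV. scale (ip x (?X (f i))) (f i)) = K (K (?X x))" for x
    using parseval_frame_operator[OF sym(2) frame, of "?X x"] by (simp add: symmetric_opD[OF sym(1)])
  then show ?thesis
    by (simp add: K_dual_def canonical_K_dual_def mp_inverse_positive(2)[OF K])
qed

text \<open>The part of the relation over \<open>J\<close> is minus the part over the complement, so it lies
  in both spans and vanishes; independence then kills its coefficients.\<close>

lemma relation_vanishes_on_independent_part:
  fixes f :: "'i::finite \<Rightarrow> 'h"
  assumes disj: "span (f ` J) \<inter> span (f ` (- J)) = {0}"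
    and inj: "inj_on f J" and indep: "independent (f ` J)"
    and rel: "(\<Sum>i\<in>UNIV. scale (c i) (f i)) = 0" and i: "i \<in> J"
  shows "c i = 0"
proof -
  let ?s = "\<lambda>S. \<Sum>i\<in>S. scale (c i) (f i)"
  have in_span: "?s S \<in> span (f ` S)" for S
    by (intro span_sum span_scale span_base imageI)
  have split: "?s J + ?s (- J) = 0"
    using rel sum.Int_Diff[of UNIV "\<lambda>i. scale (c i) (f i)" J] by (simp add: Compl_eq_Diff_UNIV)
  then have "?s J = - ?s (- J)" by (simp add: eq_neg_iff_add_eq_0)
  then have "?s J \<in> span (f ` (- J))" using span_neg[OF in_span[of "- J"]] by simp
  then have "?s J \<in> span (f ` J) \<inter> span (f ` (- J))" using in_span[of J] by (rule IntI[rotated])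
  then have "?s J = 0" using disj by blast
  \<comment> \<open>Independence concerns the set of vectors, so the coefficients are transported along \<open>f\<close>.\<close>
  then have "(\<Sum>v\<in>f ` J. scale (c (the_inv_into J f v)) v) = 0"
    using inj by (simp add: sum.reindex the_inv_into_f_f)
  from independentD[OF indep _ _ this, of "f i"] i inj show ?thesis
    by (simp add: the_inv_into_f_f)
qed

lemma K_duals_agree_on_independent_part:
  fixes f g g' :: "'i::finite \<Rightarrow> 'h"
  assumes "span (f ` J) \<inter> span (f ` (- J)) = {0}" "inj_on f J" "independent (f ` J)"
    and g: "K_dual scale ip K f g" and g': "K_dual scale ip K f g'" and i: "i \<in> J"
  shows "g i = g' i"
proof (rule ip_eqI_right)
  fix x
  have "(\<Sum>i\<in>UNIV. scale (ip x (g i) - ip x (g' i)) (f i)) = K x - K x"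
    using g g' by (simp add: K_dual_def scale_left_diff_distrib sum_subtractf)
  then have "ip x (g i) - ip x (g' i) = 0"
    using relation_vanishes_on_independent_part[OF assms(1-3) _ i, of "\<lambda>i. ip x (g i) - ip x (g' i)"]
    by simp
  then show "ip x (g i) = ip x (g' i)" by simp
qed

text \<open>The coefficient is conjugated because the dual vectors enter through the second,
  conjugate-linear argument of the inner product.\<close>

lemma K_dual_perturb:
  fixes f g :: "'i::finite \<Rightarrow> 'h"
  assumes g: "K_dual scale ip K f g" and rel: "(\<Sum>i\<in>UNIV. scale (c i) (f i)) = 0"
  shows "K_dual scale ip K f (\<lambda>i. g i + scale (scalar_conj (c i)) v)"
proof -
  have "(\<Sum>i\<in>UNIV. scale (ip x (g i + scale (scalar_conj (c i)) v)) (f i))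
      = (\<Sum>i\<in>UNIV. scale (ip x (g i)) (f i)) + scale (ip x v) (\<Sum>i\<in>UNIV. scale (c i) (f i))" for x
    by (simp add: ip_add_right ip_scale_right scale_left_distrib sum.distrib scale_sum_right mult.commute)
  with g rel show ?thesis by (simp add: K_dual_def)
qed

end

section \<open>Optimality\<close>

lemma r1_le_iff: "r1 ip f g \<le> c \<longleftrightarrow> (\<forall>i. norm (ip (f i) (g i)) \<le> c)"
  by (simp add: r1_def)

lemma spectrally_optimal_iff:
  assumes lower: "\<And>g. K_dual scale ip K f g \<Longrightarrow> M \<le> r1 ip f g"
    and attained: "K_dual scale ip K f g0" "r1 ip f g0 \<le> M"
  shows "spectrally_optimal_K_dual scale ip K f g \<longleftrightarrow> K_dual scale ip K f g \<and> r1 ip f g \<le> M"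
proof -
  have "r1 ip f g0 = M" using lower attained by (intro antisym)
  then have "r1_opt scale ip K f = M"
    unfolding r1_opt_def using lower attained(1) by (intro cInf_eq_minimum) auto
  then show ?thesis using lower by (auto simp: spectrally_optimal_K_dual_def intro: antisym)
qed

text \<open>Each strict inequality \<open>q\<^sub>i < M\<close> leaves room for a perturbation of size proportional
  to \<open>t\<close>, and the finitely many bounds on \<open>t\<close> have a positive minimum.\<close>

lemma uncountable_small_multiples:
  fixes q d :: "'i \<Rightarrow> real"
  assumes "finite J" and "\<And>i. i \<in> J \<Longrightarrow> q i < M" and "\<And>i. i \<in> J \<Longrightarrow> 0 \<le> d i"
  shows "uncountable {t. 0 < t \<and> (\<forall>i\<in>J. q i + t * d i \<le> M)}"
proof -
  \<comment> \<open>The denominators are increased by 1 to cover \<open>d i = 0\<close>, and the element 1 covers an empty index set.\<close>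
  define \<epsilon> where "\<epsilon> = Min (insert 1 ((\<lambda>i. (M - q i) / (1 + d i)) ` J))"
  have pos: "0 < \<epsilon>"
    using assms by (auto simp: \<epsilon>_def add_pos_nonneg)
  have "q i + t * d i \<le> M" if "0 < t" "t < \<epsilon>" "i \<in> J" for i t
  proof -
    have "\<epsilon> \<le> (M - q i) / (1 + d i)" using assms(1) that by (simp add: \<epsilon>_def)
    with that have "t < (M - q i) / (1 + d i)" by simp
    moreover have "0 < 1 + d i" using assms(3)[of i] that by simp
    ultimately have "t * (1 + d i) < M - q i" by (simp add: pos_less_divide_eq)
    then show ?thesis using that by (simp add: algebra_simps)
  qed
  then have "{0<..<\<epsilon>} \<subseteq> {t. 0 < t \<and> (\<forall>i\<in>J. q i + t * d i \<le> M)}" by auto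
  moreover have "uncountable {0<..<\<epsilon>}" using pos by (simp add: uncountable_open_interval)
  ultimately show ?thesis using countable_subset by blast
qed

theorem theorem4p15:
  fixes scale :: "'k::real_or_complex \<Rightarrow> 'h::ab_group_add \<Rightarrow> 'h"
    and ip :: "'h \<Rightarrow> 'h \<Rightarrow> 'k"
    and K :: "'h \<Rightarrow> 'h"
    and f :: "'i::finite \<Rightarrow> 'h"
    and n :: nat
    and M :: real
    and J1 J2 :: "'i set"
    and W1 W2 :: "'h set"
  assumes "finite_dim_hilbert scale ip"
    and "vector_space.dim scale (UNIV :: 'h set) = n" and "n \<ge> 1"
    and "positive_semidef scale ip K"
    and "parseval_K_frame ip K f" and "CARD('i) > n"
    and "M = (MAX i. (hnorm ip (op_sqrt scale ip (mp_inverse scale ip K) (f i)))\<^sup>2)"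
    and "J1 = {i. (hnorm ip (op_sqrt scale ip (mp_inverse scale ip K) (f i)))\<^sup>2 = M}"
    and "J2 = UNIV - J1"
    and "W1 = module.span scale (f ` J1)"
    and "W2 = module.span scale (f ` J2)"
    and "W1 \<inter> W2 = {0}"
    and "inj_on f J1" and "\<not> module.dependent scale (f ` J1)"
  shows "spectrally_optimal_K_dual scale ip K f (canonical_K_dual scale ip K f) \<and>
    uncountable {g. spectrally_optimal_K_dual scale ip K f g}"
proof -
  interpret H: finite_dim_hilbert scale ip by fact
  let ?X = "mp_inverse scale ip K"
  let ?q = "\<lambda>i. (hnorm ip (op_sqrt scale ip ?X (f i)))\<^sup>2"
  let ?g = "canonical_K_dual scale ip K f"
  have pos: "positive_semidef scale ip ?X" by (rule H.mp_inverse_positive(1)[OF assms(4)])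
  have diag: "norm (ip (f i) (?g i)) = ?q i" for i
    by (simp add: canonical_K_dual_def H.hnorm_op_sqrt[OF pos] norm_power)
  have q_le: "?q i \<le> M" for i using assms(7) by simp
  have "M \<in> range ?q" unfolding assms(7) by (rule Max_in) auto
  then obtain i0 where i0: "i0 \<in> J1" using assms(8) by auto
  have disj: "H.span (f ` J1) \<inter> H.span (f ` (- J1)) = {0}"
    using assms(9-12) by (simp add: Compl_eq_Diff_UNIV)
  note J1 = disj assms(13,14)
  have dual: "K_dual scale ip K f ?g" by (rule H.canonical_K_dual_is_K_dual[OF assms(4,5)])
  have lower: "M \<le> r1 ip f g" if g: "K_dual scale ip K f g" for g
  proof -
    have "M = norm (ip (f i0) (?g i0))" using i0 assms(8) diag by simp
    also have "\<dots> = norm (ip (f i0) (g i0))"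
      using H.K_duals_agree_on_independent_part[OF J1 dual g i0] by simp
    also have "\<dots> \<le> r1 ip f g" using r1_le_iff by blast
    finally show ?thesis .
  qed
  have upper: "r1 ip f ?g \<le> M" unfolding r1_le_iff diag using q_le by blast
  have opt_iff: "spectrally_optimal_K_dual scale ip K f g \<longleftrightarrow> K_dual scale ip K f g \<and> r1 ip f g \<le> M"
    for g :: "'i \<Rightarrow> 'h"
    by (rule spectrally_optimal_iff[OF _ dual upper]) (rule lower)
  have optimal: "spectrally_optimal_K_dual scale ip K f ?g"
    unfolding opt_iff using dual upper by blast

  obtain c where c: "\<exists>i\<in>UNIV. c i \<noteq> 0" and rel: "(\<Sum>i\<in>UNIV. scale (c i) (f i)) = 0"
    using H.family_dependent[of "UNIV :: 'i set" f] assms(2,6) by auto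
  then obtain k where k: "c k \<noteq> 0" by blast
  have c_J1: "c i = 0" if "i \<in> J1" for i
    by (rule H.relation_vanishes_on_independent_part[OF J1 rel that])
  obtain v :: 'h where v: "v \<noteq> 0"
  proof -
    have "\<not> (UNIV :: 'h set) \<subseteq> {0}"
    proof
      assume "(UNIV :: 'h set) \<subseteq> {0}"
      then have "H.dim (UNIV :: 'h set) \<le> card ({} :: 'h set)" by (intro H.dim_le_card) auto
      with assms(2,3) show False by simp
    qed
    then show thesis using that by blast
  qed
  \<comment> \<open>The perturbed duals; they differ for different \<open>t\<close> at the index \<open>k\<close>.\<close>
  let ?h = "\<lambda>(t::real) i. ?g i + scale (scalar_conj (of_real t * c i)) v"
  let ?d = "\<lambda>i. norm (c i) * norm (ip (f i) v)"
  let ?T = "{t. 0 < t \<and> (\<forall>i\<in>J2. ?q i + t * ?d i \<le> M)}"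
  have "spectrally_optimal_K_dual scale ip K f (?h t)" if t: "t \<in> ?T" for t
    unfolding opt_iff
  proof
    have "(\<Sum>i\<in>UNIV. scale (of_real t * c i) (f i)) = scale (of_real t) (\<Sum>i\<in>UNIV. scale (c i) (f i))"
      by (simp add: H.scale_sum_right)
    then have "(\<Sum>i\<in>UNIV. scale (of_real t * c i) (f i)) = 0" by (simp add: rel)
    then show "K_dual scale ip K f (?h t)" by (rule H.K_dual_perturb[OF dual])
    have "norm (ip (f i) (?h t i)) \<le> M" for i
    proof (cases "i \<in> J1")
      case True
      then show ?thesis using c_J1 diag q_le by (simp add: H.scale_zero_left)
    next
      case False
      then have "?q i + t * ?d i \<le> M" using t assms(9) by blast
      moreover have "norm (ip (f i) (?h t i)) \<le> ?q i + t * ?d i"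
      proof -
        have "norm (ip (f i) (?h t i)) \<le> norm (ip (f i) (?g i)) + norm (of_real t * c i * ip (f i) v)"
          by (simp add: H.ip_add_right H.ip_scale_right norm_triangle_ineq)
        then show ?thesis using t by (simp add: diag norm_mult mult.assoc)
      qed
      ultimately show ?thesis by linarith
    qed
    then show "r1 ip f (?h t) \<le> M" by (simp add: r1_le_iff)
  qed
  then have sub: "?h ` ?T \<subseteq> {g. spectrally_optimal_K_dual scale ip K f g}" by blast
  have "inj ?h"
  proof (rule injI)
    fix s t assume "?h s = ?h t"
    then have "?h s k = ?h t k" by (rule fun_cong)
    then have "scalar_conj (of_real s * c k) = scalar_conj (of_real t * c k)"
      using v by (simp add: H.scale_right_imp_eq)
    then have "of_real s * c k = of_real t * c k" by (metis scalar_conj_simps(5))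
    then show "s = t" using k by simp
  qed
  moreover have "uncountable ?T"
    using assms(8,9) q_le by (intro uncountable_small_multiples) (auto simp: less_le)
  ultimately have "uncountable (?h ` ?T)"
    using countable_image_inj_on inj_on_subset by blast
  then have "uncountable {g. spectrally_optimal_K_dual scale ip K f g}"
    using countable_subset[OF sub] by blast
  with optimal show ?thesis by blast
qed

end
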